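(* Let $\{G_i:i\in I\}$ be a set of locally bounded Hausdorff Abelian topological groups, each with the cofinally zero property, and let $G=\prod_{i\in I}G_i$ with the product topology. If, for each $i\in I$, $D_i$ is a dense subgroup of $G_i$ which determines $G_i$, then $D:=\bigoplus_{i\in I}D_i$ determines $G$.
   Context: All groups are Abelian. $\mathbb T$ is the circle group, $(-\tfrac12,\tfrac12]$ with addition mod $1$ and its usual compact metrizable topology. For a topological Abelian group $G$, $\widehat G$ is the group of continuous homomorphisms $G\to\mathbb T$ with the compact-open topology. A dense subgroup $D$ of $G$ determines $G$ if the restriction map $\widehat G\to\widehat D$, $h\mapsto h|D$ (which is always a continuous group isomorphism) is a homeomorphism. A subset $S$ of $G$ is bounded in $G$ if for every nonempty open $V\subseteq G$ there is a finite $F\subseteq G$ with $S\subseteq F+V$; $G$ is locally bounded if some nonempty open subset of $G$ is bounded. For a compact set $F\subseteq G$ put $U(F)=\{h\in\widehat G: |h(x)|<\tfrac14 \text{ for all } x\in F\}$. $G$ has the cofinally zero property if for every compact $K\subseteq G$ there is a compact $F\subseteq G$ such that every $h\in U(F)$ satisfies $h|K\equiv 0$. $\bigoplus_{i\in I}D_i$ is the set of $x\in\prod_{i\in I}D_i$ with $x_i\ne 0$ for only finitely many $i$, viewed as a subgroup of $\prod_{i\in I}G_i$. *)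

theory Defs
  imports "HOL-Analysis.Analysis" "HOL-Algebra.Product_Groups"
begin

text \<open>
  A topological Abelian group is a pair of a (multiplicatively written) group structure \<open>G\<close> in the
  sense of HOL-Algebra and an abstract topology \<open>T\<close> whose underlying set is the carrier of \<open>G\<close>.
  Explicit carriers are needed because the groups of a family may differ from index to index.
\<close>

definition topological_comm_group :: "('a, 'b) monoid_scheme \<Rightarrow> 'a topology \<Rightarrow> bool" where
  "topological_comm_group G T \<longleftrightarrow>
     comm_group G \<and> topspace T = carrier G \<and>
     continuous_map (prod_topology T T) T (\<lambda>(x, y). x \<otimes>\<^bsub>G\<^esub> y) \<and>
     continuous_map T T (\<lambda>x. inv\<^bsub>G\<^esub> x)"


subsection \<open>The circle group\<close>

definition wrap :: "real \<Rightarrow> real" where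
  "wrap t = t - of_int \<lceil>t - 1/2\<rceil>"

definition circle_group :: "real monoid" where
  "circle_group = \<lparr>carrier = {-1/2 <.. 1/2}, mult = (\<lambda>x y. wrap (x + y)), one = 0\<rparr>"

text \<open>
  The usual topology of the circle is not the subspace topology of the interval: it is the one
  that makes \<open>t \<mapsto> exp (2 \<pi> i t)\<close> a homeomorphism onto the unit circle.
\<close>

definition circle_topology :: "real topology" where
  "circle_topology = pullback_topology {-1/2 <.. 1/2} (\<lambda>t. cis (2 * pi * t)) euclidean"


subsection \<open>The dual group and determining subgroups\<close>

text \<open>
  Characters are made \<open>undefined\<close> outside the carrier, so that they are determined by their
  values on the group.
\<close>

definition characters :: "('a, 'b) monoid_scheme \<Rightarrow> 'a topology \<Rightarrow> ('a \<Rightarrow> real) set" where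
  "characters G T =
     {h \<in> hom G circle_group. continuous_map T circle_topology h} \<inter> extensional (carrier G)"

definition dual_topology :: "('a, 'b) monoid_scheme \<Rightarrow> 'a topology \<Rightarrow> ('a \<Rightarrow> real) topology" where
  "dual_topology G T = topology_generated_by
     {{h \<in> characters G T. h ` K \<subseteq> V} | K V. compactin T K \<and> openin circle_topology V}"

definition dense_subgroup :: "'a set \<Rightarrow> ('a, 'b) monoid_scheme \<Rightarrow> 'a topology \<Rightarrow> bool" where
  "dense_subgroup D G T \<longleftrightarrow> subgroup D G \<and> T closure_of D = topspace T"

definition determines :: "'a set \<Rightarrow> ('a, 'b) monoid_scheme \<Rightarrow> 'a topology \<Rightarrow> bool" where
  "determines D G T \<longleftrightarrow>
     dense_subgroup D G T \<and>
     homeomorphic_map (dual_topology G T)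
       (dual_topology (G\<lparr>carrier := D\<rparr>) (subtopology T D)) (\<lambda>h. restrict h D)"


subsection \<open>Local boundedness and the cofinally zero property\<close>

definition bounded_in_group :: "('a, 'b) monoid_scheme \<Rightarrow> 'a topology \<Rightarrow> 'a set \<Rightarrow> bool" where
  "bounded_in_group G T S \<longleftrightarrow>
     S \<subseteq> carrier G \<and>
     (\<forall>V. openin T V \<and> V \<noteq> {} \<longrightarrow> (\<exists>F. finite F \<and> F \<subseteq> carrier G \<and> S \<subseteq> F <#>\<^bsub>G\<^esub> V))"

definition locally_bounded_group :: "('a, 'b) monoid_scheme \<Rightarrow> 'a topology \<Rightarrow> bool" where
  "locally_bounded_group G T \<longleftrightarrow> (\<exists>U. openin T U \<and> U \<noteq> {} \<and> bounded_in_group G T U)"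

definition quarter_nbhd :: "('a, 'b) monoid_scheme \<Rightarrow> 'a topology \<Rightarrow> 'a set \<Rightarrow> ('a \<Rightarrow> real) set" where
  "quarter_nbhd G T F = {h \<in> characters G T. \<forall>x\<in>F. \<bar>h x\<bar> < 1/4}"

definition cofinally_zero :: "('a, 'b) monoid_scheme \<Rightarrow> 'a topology \<Rightarrow> bool" where
  "cofinally_zero G T \<longleftrightarrow>
     (\<forall>K. compactin T K \<longrightarrow>
        (\<exists>F. compactin T F \<and> (\<forall>h \<in> quarter_nbhd G T F. \<forall>x\<in>K. h x = 0)))"


subsection \<open>Direct sums\<close>

definition direct_sum :: "'i set \<Rightarrow> ('i \<Rightarrow> ('a, 'b) monoid_scheme) \<Rightarrow> ('i \<Rightarrow> 'a set) \<Rightarrow> ('i \<Rightarrow> 'a) set"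
  where "direct_sum I G D = {x \<in> (\<Pi>\<^sub>E i\<in>I. D i). finite {i \<in> I. x i \<noteq> \<one>\<^bsub>G i\<^esub>}}"

lemma direct_sum_eq_sum_group:
  assumes "\<And>i. i \<in> I \<Longrightarrow> group (G i)" "\<And>i. i \<in> I \<Longrightarrow> subgroup (D i) (G i)"
  shows "direct_sum I G D = carrier (sum_group I (\<lambda>i. (G i)\<lparr>carrier := D i\<rparr>))"
proof -
  have "group ((G i)\<lparr>carrier := D i\<rparr>)" if "i \<in> I" for i
    using assms that by (simp add: group.subgroup_imp_group)
  then show ?thesis
    by (simp add: carrier_sum_group direct_sum_def)
qed


subsection \<open>The circle is a compact metrizable topological Abelian group\<close>

lemma wrap_in: "wrap t \<in> {-1/2 <.. 1/2}"
proof -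
  have "t - 1/2 \<le> of_int \<lceil>t - 1/2\<rceil>" "of_int \<lceil>t - 1/2\<rceil> < t - 1/2 + 1"
    using ceiling_correct[of "t - 1/2"] by linarith+
  then show ?thesis
    unfolding wrap_def greaterThanAtMost_iff by linarith
qed

lemma wrap_id: "t \<in> {-1/2 <.. 1/2} \<Longrightarrow> wrap t = t"
proof -
  assume "t \<in> {-1/2 <.. 1/2}"
  then have "\<lceil>t - 1/2\<rceil> = 0"
    by (simp add: ceiling_eq_iff)
  then show ?thesis
    by (simp add: wrap_def)
qed

lemma wrap_add_int: "wrap (t + of_int n) = wrap t"
proof -
  have "t + of_int n - 1/2 = (t - 1/2) + of_int n"
    by simp
  then have "\<lceil>t + of_int n - 1/2\<rceil> = \<lceil>t - 1/2\<rceil> + n"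
    by (metis ceiling_add_of_int)
  then show ?thesis
    by (simp add: wrap_def)
qed

lemma wrap_wrap_add: "wrap (wrap s + t) = wrap (s + t)" "wrap (s + wrap t) = wrap (s + t)"
proof -
  have "wrap s + t = (s + t) + of_int (- \<lceil>s - 1/2\<rceil>)" "s + wrap t = (s + t) + of_int (- \<lceil>t - 1/2\<rceil>)"
    unfolding wrap_def of_int_minus by linarith+
  then show "wrap (wrap s + t) = wrap (s + t)" "wrap (s + wrap t) = wrap (s + t)"
    using wrap_add_int by metis+
qed

lemma cis_wrap: "cis (2 * pi * wrap t) = cis (2 * pi * t)"
proof -
  have "2 * pi * wrap t = 2 * pi * t - 2 * pi * of_int \<lceil>t - 1/2\<rceil>"
    by (simp add: wrap_def algebra_simps)
  then show ?thesis
    by (simp add: cis_multiple_2pi flip: cis_divide)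
qed

lemma comm_group_circle: "comm_group circle_group"
proof (rule comm_groupI)
  fix x assume x: "x \<in> carrier circle_group"
  have "wrap (wrap (- x) + x) = 0"
    using wrap_wrap_add(1)[of "- x" x] wrap_id[of 0] by simp
  then show "\<exists>y\<in>carrier circle_group. y \<otimes>\<^bsub>circle_group\<^esub> x = \<one>\<^bsub>circle_group\<^esub>"
    using wrap_in[of "- x"] by (intro bexI[of _ "wrap (- x)"]) (simp_all add: circle_group_def)
  show "\<one>\<^bsub>circle_group\<^esub> \<otimes>\<^bsub>circle_group\<^esub> x = x"
    using x wrap_id[of x] by (simp add: circle_group_def)
next
  fix x y assume "x \<in> carrier circle_group" "y \<in> carrier circle_group"
  show "x \<otimes>\<^bsub>circle_group\<^esub> y \<in> carrier circle_group"
    using wrap_in[of "x + y"] by (simp add: circle_group_def)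
  show "x \<otimes>\<^bsub>circle_group\<^esub> y = y \<otimes>\<^bsub>circle_group\<^esub> x"
    by (simp add: circle_group_def add.commute)
qed (simp_all add: circle_group_def wrap_wrap_add add.assoc)

lemma topspace_circle: "topspace circle_topology = {-1/2 <.. 1/2}"
  by (simp add: circle_topology_def topspace_pullback_topology)

lemma inj_on_circle: "inj_on (\<lambda>t. cis (2 * pi * t)) {-1/2 <.. 1/2}"
proof (rule inj_onI)
  have *: "Arg (cis (2 * pi * u)) = 2 * pi * u" if "u \<in> {-1/2 <.. 1/2}" for u :: real
  proof (rule Arg_cis)
    have "pi * (-1) < pi * (2 * u)"
      by (rule mult_strict_left_mono) (use that in auto)
    moreover have "pi * (2 * u) \<le> pi * 1"
      by (rule mult_left_mono) (use that in auto)
    ultimately show "2 * pi * u \<in> {-pi <.. pi}"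
      by (simp add: mult_ac)
  qed
  fix s t :: real
  assume "s \<in> {-1/2 <.. 1/2}" "t \<in> {-1/2 <.. 1/2}" "cis (2 * pi * s) = cis (2 * pi * t)"
  then have "2 * pi * s = 2 * pi * t"
    using * by metis
  then show "s = t"
    by simp
qed

lemma image_circle: "(\<lambda>t. cis (2 * pi * t)) ` {-1/2 <.. 1/2} = sphere 0 1"
proof (intro equalityI subsetI)
  fix z :: complex assume "z \<in> sphere 0 1"
  then have "z = cis (Arg z)"
    using cis_Arg[of z] by (cases "z = 0") (simp_all add: sgn_eq)
  then have "z = cis (2 * pi * wrap (Arg z / (2 * pi)))"
    by (simp add: cis_wrap)
  then show "z \<in> (\<lambda>t. cis (2 * pi * t)) ` {-1/2 <.. 1/2}"
    using wrap_in by (rule image_eqI)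
qed (simp add: image_iff, metis norm_cis)

lemma homeomorphic_map_circle:
  "homeomorphic_map circle_topology (top_of_set (sphere 0 1)) (\<lambda>t. cis (2 * pi * t))"
proof (rule bijective_open_imp_homeomorphic_map)
  show "continuous_map circle_topology (top_of_set (sphere 0 1)) (\<lambda>t. cis (2 * pi * t))"
    unfolding circle_topology_def
    using continuous_map_pullback[OF continuous_map_id, of "{-1/2 <.. 1/2}" "\<lambda>t. cis (2 * pi * t)"]
    by (auto simp: continuous_map_in_subtopology comp_def)
  show "open_map circle_topology (top_of_set (sphere 0 1)) (\<lambda>t. cis (2 * pi * t))"
    unfolding open_map_def circle_topology_def openin_pullback_topology
  proof (intro allI impI)
    fix U assume "\<exists>W. openin euclidean W \<and> U = (\<lambda>t. cis (2 * pi * t)) -` W \<inter> {-1/2 <.. 1/2}"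
    then obtain W where "open W" and U: "U = (\<lambda>t. cis (2 * pi * t)) -` W \<inter> {-1/2 <.. 1/2}"
      by auto
    have "(\<lambda>t. cis (2 * pi * t)) ` U = sphere 0 1 \<inter> W"
      unfolding U image_circle[symmetric] by blast
    then show "openin (top_of_set (sphere 0 1)) ((\<lambda>t. cis (2 * pi * t)) ` U)"
      using \<open>open W\<close> by auto
  qed
qed (simp_all only: topspace_circle topspace_euclidean_subtopology image_circle inj_on_circle)

lemma compact_space_circle: "compact_space circle_topology"
  using homeomorphic_compact_space[OF homeomorphic_map_imp_homeomorphic_space[OF homeomorphic_map_circle]]
  by (simp add: compact_space_subtopology)

lemma metrizable_space_circle: "metrizable_space circle_topology"
  using homeomorphic_metrizable_space[OF homeomorphic_map_imp_homeomorphic_space[OF homeomorphic_map_circle]]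
  by (simp add: metrizable_space_subtopology metrizable_space_euclidean)

lemma continuous_map_into_circle:
  assumes "continuous_map X euclidean (\<lambda>x. cis (2 * pi * f x))" "f \<in> topspace X \<rightarrow> {-1/2 <.. 1/2}"
  shows "continuous_map X circle_topology f"
  unfolding circle_topology_def
proof (rule continuous_map_pullback')
  show "continuous_map X euclidean ((\<lambda>t. cis (2 * pi * t)) \<circ> f)"
    using assms(1) by (simp only: comp_def)
  show "topspace X \<subseteq> f -` {-1/2 <.. 1/2}"
    using assms(2) by blast
qed

lemma continuous_map_cis_circle: "continuous_map circle_topology euclidean (\<lambda>t. cis (2 * pi * t))"
  using homeomorphic_imp_continuous_map[OF homeomorphic_map_circle]
  by (simp add: continuous_map_in_subtopology)

lemma continuous_map_mult_complex:
  fixes f g :: "'a \<Rightarrow> complex"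
  assumes "continuous_map X euclidean f" "continuous_map X euclidean g"
  shows "continuous_map X euclidean (\<lambda>x. f x * g x)"
proof -
  have "continuous_map X (prod_topology euclidean euclidean) (\<lambda>x. (f x, g x))"
    using assms by (rule continuous_map_pairedI)
  moreover have "continuous_map (prod_topology euclidean euclidean) euclidean
                   (\<lambda>p::complex \<times> complex. fst p * snd p)"
    by (auto intro!: continuous_intros)
  ultimately have "continuous_map X euclidean ((\<lambda>p. fst p * snd p) \<circ> (\<lambda>x. (f x, g x)))"
    by (rule continuous_map_compose)
  then show ?thesis
    by (simp add: comp_def)
qed

lemma topological_comm_group_circle: "topological_comm_group circle_group circle_topology"
proof -
  interpret comm_group circle_group by (rule comm_group_circle)
  have inv: "inv\<^bsub>circle_group\<^esub> x = wrap (-x)" if "x \<in> {-1/2 <.. 1/2}" for x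
  proof (rule inv_equality)
    show "wrap (- x) \<otimes>\<^bsub>circle_group\<^esub> x = \<one>\<^bsub>circle_group\<^esub>"
      using wrap_wrap_add(1)[of "- x" x] wrap_id[of 0] by (simp add: circle_group_def)
    show "x \<in> carrier circle_group" "wrap (- x) \<in> carrier circle_group"
      using that wrap_in[of "- x"] by (simp_all add: circle_group_def)
  qed
  have "continuous_map (prod_topology circle_topology circle_topology) euclidean
          (\<lambda>p. cis (2 * pi * fst p) * cis (2 * pi * snd p))"
    using continuous_map_compose[OF continuous_map_fst continuous_map_cis_circle]
      continuous_map_compose[OF continuous_map_snd continuous_map_cis_circle]
    by (intro continuous_map_mult_complex) (auto simp: comp_def)
  then have "continuous_map (prod_topology circle_topology circle_topology) circle_topology
          (\<lambda>p. wrap (fst p + snd p))"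
    by (intro continuous_map_into_circle Pi_I wrap_in) (simp add: cis_wrap cis_mult distrib_left)
  then have "continuous_map (prod_topology circle_topology circle_topology) circle_topology
          (\<lambda>(x, y). wrap (x + y))"
    by (simp only: case_prod_unfold)
  moreover
  have "continuous_map circle_topology euclidean (\<lambda>t. cnj (cis (2 * pi * t)))"
    using continuous_map_compose[OF continuous_map_cis_circle, of euclidean cnj]
    by (auto simp: comp_def continuous_on_cnj)
  then have "continuous_map circle_topology circle_topology (\<lambda>t. wrap (- t))"
    by (intro continuous_map_into_circle Pi_I wrap_in) (simp add: cis_wrap cis_cnj)
  then have "continuous_map circle_topology circle_topology (\<lambda>x. inv\<^bsub>circle_group\<^esub> x)"
    by (rule continuous_map_eq) (simp add: topspace_circle inv)
  ultimately show ?thesis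
    using comm_group_circle unfolding topological_comm_group_def topspace_circle
    by (simp add: circle_group_def)
qed

end

theory Submission
  imports Defs
begin

text \<open>
  The circle has no small subgroups: a character whose values on a subgroup all have modulus below
  $\frac14$ vanishes there. Hence a character $\varphi$ of $D = \bigoplus_i D_i$, being small on a
  basic neighbourhood of the identity, kills every element supported outside some finite set $J$ of
  indices, and so it is the finite sum over $J$ of its coordinate characters
  $\varphi_i = \varphi \circ e_i$, where $e_i$ embeds $D_i$ as the $i$-th axis
  (\<open>character_eq_finite_sum\<close>). As $D_i$ determines $G_i$, each $\varphi_i$ extends to $G_i$, and the
  sum over $J$ of the extensions extends $\varphi$ to the product. So restriction to $D$ is onto; it
  is injective because $D$ is dense.
  
  The remaining point is that the inverse of restriction is continuous. Let $K$ be a compact subset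
  of the product and $K_i$ its projections. The cofinally zero property gives a compact set of $G_i$
  such that a character small on it does not merely become small on $K_i$ but vanishes there, and
  because $D_i$ determines $G_i$ that set may be replaced by a compact $C_i \subseteq D_i$
  (\<open>determines_cofinally_zero\<close>). The axis pieces $e_i(C_i)$ together with the identity form a compact
  subset $F$ of $D$, since a neighbourhood of the identity in a product restricts only finitely many
  coordinates and thus contains all but finitely many of the pieces
  (\<open>compactin_union_of_axes\<close>). If $\varphi$ is small on $F$, then every $\varphi_i$ is small on $C_i$,
  so its extension vanishes on $K_i$, and the extension of $\varphi$ vanishes on $K$
  (\<open>extend_small_character_vanishing_on_compact\<close>). Exact vanishing is what makes this work: the number
  of coordinates that $\varphi$ involves is unbounded, so bounds on the single summands would give no
  bound on their sum. Consequently two characters of $D$ that are close on $F$ have extensions that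
  agree on $K$, which is more than continuity of the inverse requires.
\<close>

section \<open>Angles on the circle\<close>

lemma wrap_eq_iff: "wrap s = wrap t \<longleftrightarrow> cis (2 * pi * s) = cis (2 * pi * t)"
  by (metis cis_wrap inj_on_circle inj_on_eq_iff wrap_in)

lemma wrap_0 [simp]: "wrap 0 = 0"
  by (simp add: wrap_id)

lemma wrap_double_of_small:
  assumes "\<bar>t\<bar> < 1/4"
  shows "wrap (t + t) = 2 * t"
proof -
  have "t + t \<in> {-1/2 <.. 1/2}"
    using assms unfolding greaterThanAtMost_iff by linarith
  then show ?thesis
    using wrap_id[of "t + t"] by simp
qed

text \<open>
  The bound \<open>1/4\<close> on angles is the right half of the unit circle. This form makes the quarter arc
  visibly open and lets distances in the plane control differences of angles.
\<close>

lemma abs_less_quarter_iff_Re_cis_pos: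
  assumes "t \<in> {-1/2 <.. 1/2}"
  shows "\<bar>t\<bar> < 1/4 \<longleftrightarrow> 0 < Re (cis (2 * pi * t))"
proof
  assume "\<bar>t\<bar> < 1/4"
  then have "pi * \<bar>t\<bar> < pi * (1/4)"
    by (intro mult_strict_left_mono) auto
  moreover have "0 \<le> pi * \<bar>t\<bar>"
    by simp
  ultimately have "0 < cos (2 * pi * \<bar>t\<bar>)"
    by (intro cos_gt_zero_pi) linarith+
  then show "0 < Re (cis (2 * pi * t))"
    by (cases "t \<ge> 0") simp_all
next
  assume "0 < Re (cis (2 * pi * t))"
  moreover have "Re (cis (2 * pi * t)) \<le> 0" if "1/4 \<le> \<bar>t\<bar>"
  proof -
    have "\<bar>t\<bar> \<le> 1/2"
      using assms by (auto simp: abs_le_iff)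
    with that have "pi * (1/4) \<le> pi * \<bar>t\<bar>" "pi * \<bar>t\<bar> \<le> pi * (1/2)"
      by (auto intro!: mult_left_mono)
    then have "cos (2 * pi * \<bar>t\<bar>) \<le> cos (pi / 2)"
      by (intro cos_monotone_0_pi_le) auto
    then show ?thesis
      by (cases "t \<ge> 0") simp_all
  qed
  ultimately show "\<bar>t\<bar> < 1/4"
    by fastforce
qed

lemma abs_wrap_diff_less_quarter:
  assumes "cmod (cis (2 * pi * s) - cis (2 * pi * t)) < 1"
  shows "\<bar>wrap (s - t)\<bar> < 1/4"
proof -
  define w where "w = cis (2 * pi * wrap (s - t))"
  have "w - 1 = (cis (2 * pi * s) - cis (2 * pi * t)) * cis (- (2 * pi * t))"
    by (simp add: w_def cis_wrap left_diff_distrib cis_mult right_diff_distrib)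
  then have "cmod (w - 1) < 1"
    using assms by (simp add: norm_mult)
  then have "0 < Re w"
    using abs_Re_le_cmod[of "w - 1"] by simp
  then show ?thesis
    unfolding w_def using abs_less_quarter_iff_Re_cis_pos[OF wrap_in] by blast
qed

lemma openin_circle_cis_preimage:
  assumes "open W"
  shows "openin circle_topology {t \<in> {-1/2 <.. 1/2}. cis (2 * pi * t) \<in> W}"
  using openin_continuous_map_preimage[OF continuous_map_cis_circle, of W] assms
  by (simp add: topspace_circle)

lemma openin_circle_quarter_arc: "openin circle_topology {t. \<bar>t\<bar> < 1/4}"
proof -
  have "{t. \<bar>t\<bar> < 1/4} = {t \<in> {-1/2 <.. 1/2}. cis (2 * pi * t) \<in> {z. 0 < Re z}}"
  proof (rule Set.set_eqI)
    fix t :: real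
    have "t \<in> {-1/2 <.. 1/2}" if "\<bar>t\<bar> < 1/4"
      using that unfolding greaterThanAtMost_iff by linarith
    then show "t \<in> {t. \<bar>t\<bar> < 1/4} \<longleftrightarrow> t \<in> {t \<in> {-1/2 <.. 1/2}. cis (2 * pi * t) \<in> {z. 0 < Re z}}"
      using abs_less_quarter_iff_Re_cis_pos[of t] by blast
  qed
  then show ?thesis
    using openin_circle_cis_preimage[OF open_halfspace_Re_gt[of 0]] by simp
qed

lemma circle_nbhd_0_contains_arc:
  assumes "openin circle_topology V" "0 \<in> V"
  obtains n :: nat where "\<And>t. \<bar>t\<bar> < 1 / (4 * 2 ^ n) \<Longrightarrow> t \<in> V"
proof -
  from assms obtain W where W: "open W" "V = (\<lambda>t. cis (2 * pi * t)) -` W \<inter> {-1/2 <.. 1/2}"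
    by (auto simp: circle_topology_def openin_pullback_topology)
  have "open ((\<lambda>t::real. cis (2 * pi * t)) -` W)"
    by (intro open_vimage W(1) continuous_intros)
  moreover have "0 \<in> (\<lambda>t::real. cis (2 * pi * t)) -` W"
    using assms(2) W(2) by simp
  ultimately obtain d where d: "d > 0" "ball 0 d \<subseteq> (\<lambda>t::real. cis (2 * pi * t)) -` W"
    by (rule openE)
  obtain n where n: "(1/2) ^ n < d"
    using real_arch_pow_inv[OF d(1), of "1/2"] by auto
  show ?thesis
  proof (rule that)
    fix t :: real
    assume t: "\<bar>t\<bar> < 1 / (4 * 2 ^ n)"
    have "(1::real) / (4 * 2 ^ n) \<le> (1/2) ^ n"
      by (simp add: power_divide field_simps)
    moreover have "(1::real) / (4 * 2 ^ n) \<le> 1/4"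
      by (simp add: field_simps)
    ultimately have "t \<in> ball 0 d" "t \<in> {-1/2 <.. 1/2}"
      using t n unfolding greaterThanAtMost_iff mem_ball dist_real_def by linarith+
    then show "t \<in> V"
      using d(2) unfolding W(2) by blast
  qed
qed

section \<open>Characters\<close>

lemma character_in:
  assumes "h \<in> characters G T" "x \<in> carrier G"
  shows "h x \<in> {-1/2 <.. 1/2}"
  using assms by (auto simp: characters_def hom_def circle_group_def)

lemma character_mult:
  assumes "h \<in> characters G T" "x \<in> carrier G" "y \<in> carrier G"
  shows "h (x \<otimes>\<^bsub>G\<^esub> y) = wrap (h x + h y)"
  using assms by (auto simp: characters_def hom_def circle_group_def)

lemma character_wrap:
  assumes "h \<in> characters G T" "x \<in> carrier G"
  shows "wrap (h x) = h x"
  using assms by (intro wrap_id character_in)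

lemma continuous_map_cis_character:
  assumes "h \<in> characters G T"
  shows "continuous_map T euclidean (\<lambda>x. cis (2 * pi * h x))"
  using continuous_map_compose[OF _ continuous_map_cis_circle, of T h] assms
  by (simp add: characters_def comp_def)

lemma cis_character_mult:
  assumes "h \<in> characters G T" "x \<in> carrier G" "y \<in> carrier G"
  shows "cis (2 * pi * h (x \<otimes>\<^bsub>G\<^esub> y)) = cis (2 * pi * h x) * cis (2 * pi * h y)"
  by (simp add: character_mult[OF assms] cis_wrap cis_mult distrib_left)

lemma character_one:
  assumes "group G" "h \<in> characters G T"
  shows "h \<one>\<^bsub>G\<^esub> = 0"
proof -
  interpret group G by fact
  have "cis (2 * pi * h \<one>\<^bsub>G\<^esub>) = cis (2 * pi * h \<one>\<^bsub>G\<^esub>) * cis (2 * pi * h \<one>\<^bsub>G\<^esub>)"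
    using cis_character_mult[OF assms(2), of "\<one>\<^bsub>G\<^esub>" "\<one>\<^bsub>G\<^esub>"] by simp
  then have "cis (2 * pi * h \<one>\<^bsub>G\<^esub>) = cis (2 * pi * 0)"
    by simp
  then have "wrap (h \<one>\<^bsub>G\<^esub>) = 0"
    using wrap_eq_iff[of "h \<one>\<^bsub>G\<^esub>" 0] by simp
  then show ?thesis
    using character_wrap[OF assms(2)] by simp
qed

text \<open>
  A real function is a character up to \<open>wrap\<close> as soon as its composite with $t \mapsto e^{2\pi i t}$ is
  continuous and multiplicative. Sums, negatives and composites of characters are therefore checked
  in the complex numbers, where there is no cut in the circle at angle $\frac12$.
\<close>

lemma wrap_phase_in_characters:
  assumes "group G" "topspace T = carrier G"
    and cont: "continuous_map T euclidean (\<lambda>x. cis (2 * pi * a x))"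
    and mult: "\<And>x y. x \<in> carrier G \<Longrightarrow> y \<in> carrier G \<Longrightarrow>
      cis (2 * pi * a (x \<otimes>\<^bsub>G\<^esub> y)) = cis (2 * pi * a x) * cis (2 * pi * a y)"
  shows "(\<lambda>x\<in>carrier G. wrap (a x)) \<in> characters G T"
proof -
  interpret group G by fact
  have "wrap (a (x \<otimes>\<^bsub>G\<^esub> y)) = wrap (wrap (a x) + wrap (a y))"
    if "x \<in> carrier G" "y \<in> carrier G" for x y
  proof -
    have "wrap (a (x \<otimes>\<^bsub>G\<^esub> y)) = wrap (a x + a y)"
      unfolding wrap_eq_iff using mult[OF that] by (simp add: cis_mult distrib_left)
    then show ?thesis
      by (simp add: wrap_wrap_add)
  qed
  moreover have "continuous_map T circle_topology (\<lambda>x\<in>carrier G. wrap (a x))"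
  proof (rule continuous_map_into_circle)
    show "continuous_map T euclidean (\<lambda>x. cis (2 * pi * (\<lambda>x\<in>carrier G. wrap (a x)) x))"
      using cont by (rule continuous_map_eq) (simp add: assms cis_wrap)
  qed (use wrap_in assms in auto)
  moreover have "wrap (a x) \<in> {-1/2 <.. 1/2}" for x
    by (rule wrap_in)
  ultimately show ?thesis
    by (auto simp: characters_def hom_def circle_group_def)
qed

lemma character_add:
  assumes "group G" "topspace T = carrier G" "h \<in> characters G T" "k \<in> characters G T"
  shows "(\<lambda>x\<in>carrier G. wrap (h x + k x)) \<in> characters G T"
proof (rule wrap_phase_in_characters[OF assms(1,2)])
  show "continuous_map T euclidean (\<lambda>x. cis (2 * pi * (h x + k x)))"
    using continuous_map_mult_complex[OF continuous_map_cis_character[OF assms(3)]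
        continuous_map_cis_character[OF assms(4)]]
    by (simp add: cis_mult distrib_left)
  fix x y
  assume "x \<in> carrier G" "y \<in> carrier G"
  then show "cis (2 * pi * (h (x \<otimes>\<^bsub>G\<^esub> y) + k (x \<otimes>\<^bsub>G\<^esub> y)))
      = cis (2 * pi * (h x + k x)) * cis (2 * pi * (h y + k y))"
    using cis_character_mult[OF assms(3), of x y] cis_character_mult[OF assms(4), of x y]
    by (simp add: distrib_left flip: cis_mult)
qed

lemma character_minus:
  assumes "group G" "topspace T = carrier G" "h \<in> characters G T"
  shows "(\<lambda>x\<in>carrier G. wrap (- h x)) \<in> characters G T"
proof (rule wrap_phase_in_characters[OF assms(1,2)])
  have "continuous_map euclidean euclidean cnj"
    by (simp add: continuous_on_cnj)
  from continuous_map_compose[OF continuous_map_cis_character[OF assms(3)] this]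
  show "continuous_map T euclidean (\<lambda>x. cis (2 * pi * - h x))"
    by (simp add: comp_def cis_cnj)
  fix x y
  assume "x \<in> carrier G" "y \<in> carrier G"
  then have "cnj (cis (2 * pi * h (x \<otimes>\<^bsub>G\<^esub> y))) = cnj (cis (2 * pi * h x) * cis (2 * pi * h y))"
    using cis_character_mult[OF assms(3), of x y] by simp
  then show "cis (2 * pi * - h (x \<otimes>\<^bsub>G\<^esub> y)) = cis (2 * pi * - h x) * cis (2 * pi * - h y)"
    by (simp add: cis_cnj)
qed

lemma character_diff:
  assumes "group G" "topspace T = carrier G" "h \<in> characters G T" "k \<in> characters G T"
  shows "(\<lambda>x\<in>carrier G. wrap (h x - k x)) \<in> characters G T"
proof -
  have "(\<lambda>x\<in>carrier G. wrap (h x + (\<lambda>x\<in>carrier G. wrap (- k x)) x)) \<in> characters G T"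
    by (intro character_add character_minus assms)
  moreover have "(\<lambda>x\<in>carrier G. wrap (h x + (\<lambda>x\<in>carrier G. wrap (- k x)) x))
      = (\<lambda>x\<in>carrier G. wrap (h x - k x))"
    by (auto simp: fun_eq_iff wrap_wrap_add)
  ultimately show ?thesis
    by simp
qed

lemma zero_character:
  assumes "group G" "topspace T = carrier G"
  shows "(\<lambda>x\<in>carrier G. 0) \<in> characters G T"
  using wrap_phase_in_characters[OF assms, of "\<lambda>_. 0"] by simp

lemma character_comp_hom:
  assumes "group H" "topspace S = carrier H" "f \<in> hom H G" "continuous_map S T f"
    and h: "h \<in> characters G T"
  shows "(\<lambda>x\<in>carrier H. h (f x)) \<in> characters H S"
proof -
  have fc: "f x \<in> carrier G" if "x \<in> carrier H" for x
    using assms(3) that by (auto simp: hom_def)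
  have "(\<lambda>x\<in>carrier H. wrap (h (f x))) \<in> characters H S"
  proof (rule wrap_phase_in_characters[OF assms(1,2)])
    show "continuous_map S euclidean (\<lambda>x. cis (2 * pi * h (f x)))"
      using continuous_map_compose[OF assms(4) continuous_map_cis_character[OF h]]
      by (simp add: comp_def)
    fix x y
    assume "x \<in> carrier H" "y \<in> carrier H"
    then show "cis (2 * pi * h (f (x \<otimes>\<^bsub>H\<^esub> y))) = cis (2 * pi * h (f x)) * cis (2 * pi * h (f y))"
      using assms(3) fc cis_character_mult[OF h, of "f x" "f y"] by (simp add: hom_def)
  qed
  moreover have "(\<lambda>x\<in>carrier H. wrap (h (f x))) = (\<lambda>x\<in>carrier H. h (f x))"
    using character_wrap[OF h fc] by (auto simp: fun_eq_iff)
  ultimately show ?thesis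
    by simp
qed

lemma characters_eqI_dense:
  assumes "T closure_of D = topspace T" "topspace T = carrier G"
    and "h \<in> characters G T" "k \<in> characters G T" "\<And>x. x \<in> D \<Longrightarrow> h x = k x"
  shows "h = k"
proof (rule extensionalityI)
  show "h \<in> extensional (carrier G)" "k \<in> extensional (carrier G)"
    using assms by (auto simp: characters_def)
  have cont: "continuous_map T circle_topology h" "continuous_map T circle_topology k"
    using assms(3,4) by (auto simp: characters_def)
  fix x
  assume "x \<in> carrier G"
  then have "x \<in> T closure_of D"
    using assms(1,2) by simp
  then show "h x = k x"
    using metrizable_imp_Hausdorff_space[OF metrizable_space_circle] cont assms(5)
    by (rule forall_in_closure_of_eq)
qed

text \<open>
  The circle has no small subgroups. An angle below $\frac14$ is doubled without wrapping around, so
  on a set closed under squaring the bound $\frac14$ improves to $\frac14 2^{-n}$ for every $n$.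
\<close>

lemma small_character_vanishes:
  assumes "h \<in> characters G T" "S \<subseteq> carrier G"
    and "\<And>x. x \<in> S \<Longrightarrow> x \<otimes>\<^bsub>G\<^esub> x \<in> S" "\<And>x. x \<in> S \<Longrightarrow> \<bar>h x\<bar> < 1/4" "x \<in> S"
  shows "h x = 0"
proof -
  have small: "\<bar>h x\<bar> < 1 / (4 * 2 ^ n)" if "x \<in> S" for x n
    using that
  proof (induction n arbitrary: x)
    case 0
    then show ?case
      using assms(4) by simp
  next
    case (Suc n)
    have "x \<in> carrier G"
      using Suc.prems assms(2) by blast
    then have "h (x \<otimes>\<^bsub>G\<^esub> x) = 2 * h x"
      using character_mult[OF assms(1)] wrap_double_of_small[OF assms(4)[OF Suc.prems]] by simp
    then have "2 * \<bar>h x\<bar> < 1 / (4 * 2 ^ n)"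
      using Suc.IH[OF assms(3)[OF Suc.prems]] by (simp add: abs_mult)
    then show ?case
      by (simp add: field_simps)
  qed
  show ?thesis
  proof (rule ccontr)
    assume "h x \<noteq> 0"
    then obtain n where "(1/2) ^ n < \<bar>h x\<bar>"
      using real_arch_pow_inv[of "\<bar>h x\<bar>" "1/2"] by auto
    moreover have "(1::real) / (4 * 2 ^ n) \<le> (1/2) ^ n"
      by (simp add: power_divide field_simps)
    ultimately show False
      using small[OF assms(5), of n] by linarith
  qed
qed

section \<open>The compact-open topology on the dual\<close>

lemma openin_dual_subbasic:
  assumes "compactin T K" "openin circle_topology V"
  shows "openin (dual_topology G T) {h \<in> characters G T. h ` K \<subseteq> V}"
  unfolding dual_topology_def by (rule topology_generated_by_Basis) (use assms in auto)

lemma topspace_dual_topology [simp]: "topspace (dual_topology G T) = characters G T"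
proof -
  let ?B = "{{h \<in> characters G T. h ` K \<subseteq> V} | K V. compactin T K \<and> openin circle_topology V}"
  have "{h \<in> characters G T. h ` {} \<subseteq> {}} \<in> ?B"
    using compactin_empty openin_empty by blast
  then have "\<Union> ?B = characters G T"
    by auto
  then show ?thesis
    unfolding dual_topology_def topology_generated_by_topspace .
qed

lemma continuous_map_into_dualI:
  assumes "f \<in> topspace X \<rightarrow> characters G T"
    and "\<And>K V. compactin T K \<Longrightarrow> openin circle_topology V \<Longrightarrow>
      openin X {x \<in> topspace X. f x ` K \<subseteq> V}"
  shows "continuous_map X (dual_topology G T) f"
  unfolding dual_topology_def
proof (rule continuous_on_generated_topo)
  show "f ` topspace X \<subseteq> \<Union> {{h \<in> characters G T. h ` K \<subseteq> V} |K V.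
      compactin T K \<and> openin circle_topology V}"
    using assms(1) topspace_dual_topology[of G T]
    unfolding dual_topology_def topology_generated_by_topspace by auto
  fix U
  assume "U \<in> {{h \<in> characters G T. h ` K \<subseteq> V} |K V. compactin T K \<and> openin circle_topology V}"
  then obtain K V where KV: "compactin T K" "openin circle_topology V"
    and U: "U = {h \<in> characters G T. h ` K \<subseteq> V}"
    by blast
  have "f -` U \<inter> topspace X = {x \<in> topspace X. f x ` K \<subseteq> V}"
    using assms(1) U by auto
  then show "openin X (f -` U \<inter> topspace X)"
    using assms(2)[OF KV] by simp
qed

lemma openin_quarter_nbhd:
  assumes "compactin T F"
  shows "openin (dual_topology G T) (quarter_nbhd G T F)"
proof -
  have "quarter_nbhd G T F = {h \<in> characters G T. h ` F \<subseteq> {t. \<bar>t\<bar> < 1/4}}"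
    by (auto simp: quarter_nbhd_def image_subset_iff)
  then show ?thesis
    using openin_dual_subbasic[OF assms openin_circle_quarter_arc, of G] by simp
qed

text \<open>
  Neighbourhoods of the zero character can be described with the single bound $\frac14$: adjoining
  the squares of the elements of a compact set keeps it compact and halves the bound that holds on
  the original set.
\<close>

lemma quarter_nbhd_refine:
  assumes sq: "continuous_map T T (\<lambda>x. x \<otimes>\<^bsub>G\<^esub> x)" and T: "topspace T = carrier G"
    and "compactin T C"
  shows "\<exists>C'. compactin T C' \<and> (\<forall>h\<in>quarter_nbhd G T C'. \<forall>x\<in>C. \<bar>h x\<bar> < 1 / (4 * 2 ^ n))"
  using assms(3)
proof (induction n arbitrary: C)
  case 0
  then show ?case
    by (intro exI[of _ C]) (auto simp: quarter_nbhd_def)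
next
  case (Suc n)
  have C: "compactin T (C \<union> (\<lambda>x. x \<otimes>\<^bsub>G\<^esub> x) ` C)"
    using Suc.prems sq by (intro compactin_Un image_compactin)
  obtain C' where C': "compactin T C'"
    "\<And>h x. h \<in> quarter_nbhd G T C' \<Longrightarrow> x \<in> C \<union> (\<lambda>x. x \<otimes>\<^bsub>G\<^esub> x) ` C \<Longrightarrow> \<bar>h x\<bar> < 1 / (4 * 2 ^ n)"
    using Suc.IH[OF C] by blast
  have "\<bar>h x\<bar> < 1 / (4 * 2 ^ Suc n)" if h: "h \<in> quarter_nbhd G T C'" and x: "x \<in> C" for h x
  proof -
    have "(1::real) / (4 * 2 ^ n) \<le> 1/4"
      by (simp add: field_simps)
    then have "\<bar>h x\<bar> < 1/4"
      using C'(2)[OF h, of x, OF UnI1[OF x]] by linarith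
    moreover have "x \<in> carrier G"
      using compactin_subset_topspace[OF Suc.prems] x T by auto
    ultimately have "h (x \<otimes>\<^bsub>G\<^esub> x) = 2 * h x"
      using h character_mult[of h G T x x] wrap_double_of_small by (simp add: quarter_nbhd_def)
    then have "2 * \<bar>h x\<bar> < 1 / (4 * 2 ^ n)"
      using C'(2)[OF h, of "x \<otimes>\<^bsub>G\<^esub> x"] x by (simp add: abs_mult)
    then show ?thesis
      by (simp add: field_simps)
  qed
  then show ?case
    using C'(1) by blast
qed

lemma dual_nbhd_zero_contains_quarter_nbhd:
  assumes sq: "continuous_map T T (\<lambda>x. x \<otimes>\<^bsub>G\<^esub> x)" and T: "topspace T = carrier G"
    and "openin (dual_topology G T) W" "(\<lambda>x\<in>carrier G. 0) \<in> W"
  shows "\<exists>C. compactin T C \<and> quarter_nbhd G T C \<subseteq> W"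
  using openin_topology_generated_by[OF assms(3)[unfolded dual_topology_def]] assms(4)
proof (induction rule: generate_topology_on.induct)
  case (Int A B)
  then obtain C C' where "compactin T C" "quarter_nbhd G T C \<subseteq> A"
    "compactin T C'" "quarter_nbhd G T C' \<subseteq> B"
    by blast
  then show ?case
    by (intro exI[of _ "C \<union> C'"]) (auto simp: quarter_nbhd_def compactin_Un)
next
  case (Basis W)
  then obtain K V where K: "compactin T K" "openin circle_topology V"
    and W: "W = {h \<in> characters G T. h ` K \<subseteq> V}"
    by blast
  show ?case
  proof (cases "K = {}")
    case True
    then show ?thesis
      using K(1) by (intro exI[of _ "{}"]) (auto simp: W quarter_nbhd_def)
  next
    case False
    have "0 \<in> V"
      using False Basis.prems compactin_subset_topspace[OF K(1)] T unfolding W by fastforce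
    then obtain n where n: "\<And>t. \<bar>t\<bar> < 1 / (4 * 2 ^ n) \<Longrightarrow> t \<in> V"
      using circle_nbhd_0_contains_arc[OF K(2)] by blast
    obtain C where "compactin T C" "\<And>h x. h \<in> quarter_nbhd G T C \<Longrightarrow> x \<in> K \<Longrightarrow> \<bar>h x\<bar> < 1 / (4 * 2 ^ n)"
      using quarter_nbhd_refine[OF sq T K(1)] by blast
    then show ?thesis
      using n by (intro exI[of _ C]) (auto simp: W quarter_nbhd_def)
  qed
qed blast+

text \<open>
  Translates of the basic neighbourhoods of zero are neighbourhoods in the compact-open topology. A
  finite net of the circle cuts $F$ into finitely many compact pieces on each of which $e^{2\pi i h}$ stays
  within distance $\frac14$ of one point; requiring $e^{2\pi i k}$ to stay within $\frac12$ of that point on the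
  same piece is an open condition on $k$, and $\frac14 + \frac12 < 1$ keeps the angle between $k$ and
  $h$ below a quarter turn.
\<close>

lemma dual_nbhd_translate:
  assumes T: "topspace T = carrier G" and h: "h \<in> characters G T" and F: "compactin T F"
  obtains W where "openin (dual_topology G T) W" "h \<in> W"
    "\<And>k x. k \<in> W \<Longrightarrow> x \<in> F \<Longrightarrow> \<bar>wrap (k x - h x)\<bar> < 1/4"
proof -
  have "compact (sphere (0::complex) 1)"
    by simp
  moreover have "sphere (0::complex) 1 \<subseteq> (\<Union>z\<in>sphere 0 1. ball z (1/4))"
    by (intro subsetI UN_I) auto
  ultimately obtain N where N: "finite N" "sphere (0::complex) 1 \<subseteq> (\<Union>z\<in>N. ball z (1/4))"
    using compactE_image[of "sphere (0::complex) 1" "sphere 0 1" "\<lambda>z. ball z (1/4)"] open_ball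
    by metis
  \<comment> \<open>Pieces are closed and arcs are open, with different radii: the given character maps each piece
    well inside the corresponding arc.\<close>
  define piece where "piece z = {x \<in> topspace T. cis (2 * pi * h x) \<in> cball z (1/4)} \<inter> F" for z
  define arc where "arc z = {t \<in> {-1/2 <.. 1/2}. cis (2 * pi * t) \<in> ball z (1/2)}" for z
  define W where "W = (\<Inter>z\<in>N. {k \<in> characters G T. k ` piece z \<subseteq> arc z}) \<inter> characters G T"
  have piece: "compactin T (piece z)" for z
    unfolding piece_def using continuous_map_cis_character[OF h] F
    by (intro closed_Int_compactin closedin_continuous_map_preimage) auto
  have arc: "openin circle_topology (arc z)" for z
    unfolding arc_def by (intro openin_circle_cis_preimage) simp
  have F_sub: "F \<subseteq> carrier G"
    using compactin_subset_topspace[OF F] T by simp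
  show ?thesis
  proof (rule that)
    show "openin (dual_topology G T) W"
    proof (cases "N = {}")
      case True
      then show ?thesis
        using openin_topspace[of "dual_topology G T"] by (simp add: W_def)
    next
      case False
      then have "openin (dual_topology G T) (\<Inter>z\<in>N. {k \<in> characters G T. k ` piece z \<subseteq> arc z})"
        by (intro openin_INT2 N(1) openin_dual_subbasic piece arc)
      moreover have "W = (\<Inter>z\<in>N. {k \<in> characters G T. k ` piece z \<subseteq> arc z})"
        using False unfolding W_def by blast
      ultimately show ?thesis
        by simp
    qed
    show "h \<in> W"
      unfolding W_def
    proof (intro IntI INT_I CollectI conjI h image_subsetI)
      fix z x
      assume "x \<in> piece z"
      then show "h x \<in> arc z"
        using character_in[OF h, of x] T unfolding piece_def arc_def by auto
    qed
    fix k x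
    assume k: "k \<in> W" and x: "x \<in> F"
    obtain z where z: "z \<in> N" "cis (2 * pi * h x) \<in> ball z (1/4)"
      using subsetD[OF N(2), of "cis (2 * pi * h x)"] by auto
    then have "x \<in> piece z"
      using x F_sub T by (auto simp: piece_def)
    then have "cis (2 * pi * k x) \<in> ball z (1/2)"
      using k z(1) by (auto simp: W_def arc_def)
    with z(2) have "dist (cis (2 * pi * k x)) (cis (2 * pi * h x)) < 1"
      using dist_triangle3[of "cis (2 * pi * k x)" "cis (2 * pi * h x)" z] by auto
    then show "\<bar>wrap (k x - h x)\<bar> < 1/4"
      by (intro abs_wrap_diff_less_quarter) (simp add: dist_norm)
  qed
qed

section \<open>Characters of direct sums inside products\<close>

locale subgroups_of_topological_groups =
  fixes I :: "'i set"
    and G :: "'i \<Rightarrow> ('a, 'b) monoid_scheme"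
    and T :: "'i \<Rightarrow> 'a topology"
    and D :: "'i \<Rightarrow> 'a set"
  assumes topological_comm_group: "i \<in> I \<Longrightarrow> topological_comm_group (G i) (T i)"
    and subgroup: "i \<in> I \<Longrightarrow> subgroup (D i) (G i)"
begin

abbreviation "ProdG \<equiv> product_group I G"
abbreviation "ProdT \<equiv> product_topology T I"
abbreviation "sum_carrier \<equiv> direct_sum I G D"
abbreviation "SumG \<equiv> ProdG\<lparr>carrier := sum_carrier\<rparr>"
abbreviation "SumT \<equiv> subtopology ProdT sum_carrier"
abbreviation "SubG i \<equiv> (G i)\<lparr>carrier := D i\<rparr>"
abbreviation "SubT i \<equiv> subtopology (T i) (D i)"

lemma group_G: "i \<in> I \<Longrightarrow> group (G i)"
  using topological_comm_group by (auto simp: topological_comm_group_def comm_group_def)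

lemma topspace_T: "i \<in> I \<Longrightarrow> topspace (T i) = carrier (G i)"
  using topological_comm_group by (auto simp: topological_comm_group_def)

lemma D_subset: "i \<in> I \<Longrightarrow> D i \<subseteq> carrier (G i)"
  using subgroup by (auto dest: subgroup.subset)

lemma one_in_D: "i \<in> I \<Longrightarrow> \<one>\<^bsub>G i\<^esub> \<in> D i"
  using subgroup by (auto dest: subgroup.one_closed)

lemma one_in_G: "i \<in> I \<Longrightarrow> \<one>\<^bsub>G i\<^esub> \<in> carrier (G i)"
  using one_in_D D_subset by blast

lemma group_Sub: "i \<in> I \<Longrightarrow> group (SubG i)"
  using group.subgroup_imp_group[OF group_G subgroup] .

lemma topspace_Sub: "i \<in> I \<Longrightarrow> topspace (SubT i) = carrier (SubG i)"
  using topspace_T D_subset by auto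

lemma group_Prod: "group ProdG"
  by (intro product_group group_G)

lemma topspace_Prod: "topspace ProdT = carrier ProdG"
  by (auto simp: topspace_T intro!: PiE_cong)

lemma direct_sum_subset: "sum_carrier \<subseteq> carrier ProdG"
  using D_subset by (fastforce simp: direct_sum_def PiE_iff extensional_def)

lemma subgroup_direct_sum: "subgroup sum_carrier ProdG"
proof -
  interpret P: group ProdG by (rule group_Prod)
  show ?thesis
  proof (rule P.subgroupI)
    show "sum_carrier \<subseteq> carrier ProdG"
      by (rule direct_sum_subset)
    have "(\<lambda>i\<in>I. \<one>\<^bsub>G i\<^esub>) \<in> sum_carrier"
      by (auto simp: direct_sum_def one_in_D)
    then show "sum_carrier \<noteq> {}"
      by blast
  next
    fix x
    assume x: "x \<in> sum_carrier"
    then have inv: "inv\<^bsub>ProdG\<^esub> x = (\<lambda>i\<in>I. inv\<^bsub>G i\<^esub> x i)"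
      using direct_sum_subset by (intro inv_product_group group_G) auto
    have "{i \<in> I. inv\<^bsub>G i\<^esub> x i \<noteq> \<one>\<^bsub>G i\<^esub>} \<subseteq> {i \<in> I. x i \<noteq> \<one>\<^bsub>G i\<^esub>}"
      using group_G by (auto simp: group.is_monoid monoid.inv_one)
    moreover have "inv\<^bsub>G i\<^esub> x i \<in> D i" if "i \<in> I" for i
      using x that subgroup by (auto simp: direct_sum_def PiE_iff subgroup.m_inv_closed)
    ultimately show "inv\<^bsub>ProdG\<^esub> x \<in> sum_carrier"
      using x unfolding inv by (auto simp: direct_sum_def cong: conj_cong intro: finite_subset)
  next
    fix x y
    assume xy: "x \<in> sum_carrier" "y \<in> sum_carrier"
    have "{i \<in> I. x i \<otimes>\<^bsub>G i\<^esub> y i \<noteq> \<one>\<^bsub>G i\<^esub>} \<subseteq> {i \<in> I. x i \<noteq> \<one>\<^bsub>G i\<^esub>} \<union> {i \<in> I. y i \<noteq> \<one>\<^bsub>G i\<^esub>}"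
      using group_G by (auto simp: group.is_monoid monoid.l_one one_in_G)
    moreover have "finite ({i \<in> I. x i \<noteq> \<one>\<^bsub>G i\<^esub>} \<union> {i \<in> I. y i \<noteq> \<one>\<^bsub>G i\<^esub>})"
      using xy by (auto simp: direct_sum_def)
    ultimately have "finite {i \<in> I. x i \<otimes>\<^bsub>G i\<^esub> y i \<noteq> \<one>\<^bsub>G i\<^esub>}"
      by (rule finite_subset)
    moreover have "x i \<otimes>\<^bsub>G i\<^esub> y i \<in> D i" if "i \<in> I" for i
      using xy that subgroup by (auto simp: direct_sum_def PiE_iff subgroup.m_closed)
    ultimately show "x \<otimes>\<^bsub>ProdG\<^esub> y \<in> sum_carrier"
      by (auto simp: direct_sum_def cong: conj_cong)
  qed
qed

lemma group_Sum: "group SumG"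
  using group.subgroup_imp_group[OF group_Prod subgroup_direct_sum] .

lemma topspace_Sum: "topspace SumT = carrier SumG"
  using topspace_Prod direct_sum_subset by auto

lemma Sum_coord: "x \<in> sum_carrier \<Longrightarrow> i \<in> I \<Longrightarrow> x i \<in> D i"
  by (auto simp: direct_sum_def)

definition single :: "'i \<Rightarrow> 'a \<Rightarrow> 'i \<Rightarrow> 'a" where
  "single i d = (\<lambda>j\<in>I. if j = i then d else \<one>\<^bsub>G j\<^esub>)"

lemma single_in_direct_sum:
  assumes "i \<in> I" "d \<in> D i"
  shows "single i d \<in> sum_carrier"
proof -
  have "{j \<in> I. single i d j \<noteq> \<one>\<^bsub>G j\<^esub>} \<subseteq> {i}"
    by (auto simp: single_def)
  then show ?thesis
    using assms by (auto simp: direct_sum_def single_def one_in_D intro: finite_subset)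
qed

lemma single_hom:
  assumes "i \<in> I"
  shows "single i \<in> hom (SubG i) SumG"
proof (rule homI)
  fix c d
  assume "c \<in> carrier (SubG i)" "d \<in> carrier (SubG i)"
  show "single i (c \<otimes>\<^bsub>SubG i\<^esub> d) = single i c \<otimes>\<^bsub>SumG\<^esub> single i d"
    using group_G one_in_G by (auto simp: single_def fun_eq_iff group.is_monoid monoid.l_one)
qed (use assms single_in_direct_sum in auto)

lemma continuous_map_single:
  assumes "i \<in> I"
  shows "continuous_map (SubT i) SumT (single i)"
proof -
  have "continuous_map (T i) ProdT (single i)"
    unfolding continuous_map_componentwise
  proof (intro conjI ballI)
    show "single i ` topspace (T i) \<subseteq> extensional I"
      by (auto simp: single_def)
    fix k
    assume "k \<in> I"
    then show "continuous_map (T i) (T k) (\<lambda>d. single i d k)"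
      using one_in_G[of k] topspace_T[of k] by (cases "k = i") (simp_all add: single_def)
  qed
  then show ?thesis
    using assms single_in_direct_sum D_subset topspace_T
    by (auto simp: continuous_map_in_subtopology intro: continuous_map_from_subtopology)
qed

definition coordinate_character :: "(('i \<Rightarrow> 'a) \<Rightarrow> real) \<Rightarrow> 'i \<Rightarrow> 'a \<Rightarrow> real" where
  "coordinate_character \<phi> i = (\<lambda>d\<in>D i. \<phi> (single i d))"

lemma coordinate_character:
  assumes "\<phi> \<in> characters SumG SumT" "i \<in> I"
  shows "coordinate_character \<phi> i \<in> characters (SubG i) (SubT i)"
  using character_comp_hom[OF group_Sub topspace_Sub single_hom continuous_map_single assms(1)] assms(2)
  by (simp add: coordinate_character_def)

text \<open>
  A character is small on a basic neighbourhood of the identity, which leaves all but finitely many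
  coordinates free and hence contains the subgroup of all elements that are trivial at the
  restricted coordinates.
\<close>

lemma character_kills_cofinite_part:
  assumes \<phi>: "\<phi> \<in> characters SumG SumT"
  obtains J where "finite J" "J \<subseteq> I"
    "\<And>x. x \<in> sum_carrier \<Longrightarrow> (\<And>j. j \<in> J \<Longrightarrow> x j = \<one>\<^bsub>G j\<^esub>) \<Longrightarrow> \<phi> x = 0"
proof -
  have "openin SumT {x \<in> topspace SumT. \<phi> x \<in> {t. \<bar>t\<bar> < 1/4}}"
    using \<phi> openin_circle_quarter_arc
    by (intro openin_continuous_map_preimage[of _ circle_topology]) (auto simp: characters_def)
  then obtain W where W: "openin ProdT W" "{x \<in> topspace SumT. \<phi> x \<in> {t. \<bar>t\<bar> < 1/4}} = W \<inter> sum_carrier"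
    by (auto simp: openin_subtopology)
  have "\<one>\<^bsub>SumG\<^esub> \<in> {x \<in> topspace SumT. \<phi> x \<in> {t. \<bar>t\<bar> < 1/4}}"
    using character_one[OF group_Sum \<phi>] monoid.one_closed[OF group.is_monoid[OF group_Sum]]
    unfolding topspace_Sum by simp
  then have "(\<lambda>i\<in>I. \<one>\<^bsub>G i\<^esub>) \<in> W"
    unfolding W(2) by simp
  from W(1)[unfolded openin_product_topology_alt, THEN bspec, OF this]
  obtain U where fin: "finite {i \<in> I. U i \<noteq> topspace (T i)}"
    and one: "(\<lambda>i\<in>I. \<one>\<^bsub>G i\<^esub>) \<in> Pi\<^sub>E I U" and U: "Pi\<^sub>E I U \<subseteq> W"
    by blast
  define J where "J = {i \<in> I. U i \<noteq> topspace (T i)}"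
  \<comment> \<open>The subgroup of elements that are trivial on \<open>J\<close>; it lies inside the neighbourhood \<open>U\<close>.\<close>
  define N where "N = {x \<in> sum_carrier. \<forall>j\<in>J. x j = \<one>\<^bsub>G j\<^esub>}"
  have N_in_U: "x \<in> Pi\<^sub>E I U" if "x \<in> N" for x
  proof (rule PiE_I)
    fix i
    assume i: "i \<in> I"
    show "x i \<in> U i"
    proof (cases "i \<in> J")
      case True
      then show ?thesis
        using that PiE_mem[OF one i] i by (simp add: N_def)
    next
      case False
      then show ?thesis
        using that i Sum_coord[of x i] D_subset[OF i] topspace_T[OF i] by (auto simp: N_def J_def)
    qed
  qed (use that in \<open>auto simp: N_def direct_sum_def PiE_iff extensional_def\<close>)
  have small: "\<bar>\<phi> x\<bar> < 1/4" if "x \<in> N" for x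
  proof -
    have "x \<in> W \<inter> sum_carrier"
      using that U N_in_U[OF that] by (auto simp: N_def)
    then show ?thesis
      unfolding W(2)[symmetric] by simp
  qed
  have double: "x \<otimes>\<^bsub>SumG\<^esub> x \<in> N" if "x \<in> N" for x
  proof -
    have "x \<otimes>\<^bsub>SumG\<^esub> x \<in> sum_carrier"
      using that subgroup.m_closed[OF subgroup_direct_sum, of x x] by (simp add: N_def)
    then show ?thesis
      using that group_G one_in_G by (auto simp: N_def J_def group.is_monoid monoid.l_one)
  qed
  show ?thesis
  proof (rule that)
    show "finite J" "J \<subseteq> I"
      using fin by (auto simp: J_def)
    fix x
    assume "x \<in> sum_carrier" "\<And>j. j \<in> J \<Longrightarrow> x j = \<one>\<^bsub>G j\<^esub>"
    then have "x \<in> N"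
      by (simp add: N_def)
    moreover have "N \<subseteq> carrier SumG"
      by (auto simp: N_def)
    ultimately show "\<phi> x = 0"
      using small_character_vanishes[OF \<phi> \<open>N \<subseteq> carrier SumG\<close> double small] by simp
  qed
qed

definition truncate :: "'i set \<Rightarrow> ('i \<Rightarrow> 'a) \<Rightarrow> 'i \<Rightarrow> 'a" where
  "truncate A x = (\<lambda>j\<in>I. if j \<in> A then x j else \<one>\<^bsub>G j\<^esub>)"

lemma truncate_in_direct_sum:
  assumes "x \<in> sum_carrier"
  shows "truncate A x \<in> sum_carrier"
proof -
  have "{j \<in> I. truncate A x j \<noteq> \<one>\<^bsub>G j\<^esub>} \<subseteq> {j \<in> I. x j \<noteq> \<one>\<^bsub>G j\<^esub>}"
    by (auto simp: truncate_def)
  moreover have "truncate A x \<in> Pi\<^sub>E I D"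
    using assms by (auto simp: truncate_def one_in_D Sum_coord)
  ultimately show ?thesis
    using assms by (auto simp: direct_sum_def intro: finite_subset)
qed

lemma character_truncate:
  assumes \<phi>: "\<phi> \<in> characters SumG SumT" and x: "x \<in> sum_carrier"
    and "finite A" "A \<subseteq> I"
  shows "\<phi> (truncate A x) = wrap (\<Sum>i\<in>A. \<phi> (single i (x i)))"
  using assms(3,4)
proof (induction A rule: finite_induct)
  case empty
  have "truncate {} x = \<one>\<^bsub>SumG\<^esub>"
    by (simp add: truncate_def)
  then show ?case
    using character_one[OF group_Sum \<phi>] by (simp only: wrap_0 sum.empty)
next
  case (insert a A)
  have a: "single a (x a) \<in> sum_carrier"
    using insert.prems x by (intro single_in_direct_sum Sum_coord) auto
  have "truncate (insert a A) x = single a (x a) \<otimes>\<^bsub>SumG\<^esub> truncate A x"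
    using insert.hyps group_G one_in_G Sum_coord[OF x] D_subset
    by (auto simp: truncate_def single_def fun_eq_iff group.is_monoid monoid.l_one monoid.r_one subset_iff)
  then have "\<phi> (truncate (insert a A) x) = wrap (\<phi> (single a (x a)) + \<phi> (truncate A x))"
    using character_mult[OF \<phi>, of "single a (x a)" "truncate A x"] a truncate_in_direct_sum[OF x] by simp
  then show ?case
    using insert by (simp add: wrap_wrap_add)
qed

lemma character_eq_finite_sum:
  assumes \<phi>: "\<phi> \<in> characters SumG SumT"
  obtains J where "finite J" "J \<subseteq> I"
    "\<And>x. x \<in> sum_carrier \<Longrightarrow> \<phi> x = wrap (\<Sum>i\<in>J. \<phi> (single i (x i)))"
proof -
  obtain J where J: "finite J" "J \<subseteq> I"
    and kill: "\<And>x. x \<in> sum_carrier \<Longrightarrow> (\<And>j. j \<in> J \<Longrightarrow> x j = \<one>\<^bsub>G j\<^esub>) \<Longrightarrow> \<phi> x = 0"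
    using character_kills_cofinite_part[OF \<phi>] by blast
  show ?thesis
  proof (rule that[OF J])
    fix x
    assume x: "x \<in> sum_carrier"
    have xi: "x i \<in> carrier (G i)" if "i \<in> I" for i
      using Sum_coord[OF x that] D_subset[OF that] by blast
    \<comment> \<open>The second factor is supported off \<open>J\<close>, so \<open>\<phi>\<close> kills it.\<close>
    have "x = truncate J x \<otimes>\<^bsub>SumG\<^esub> truncate (I - J) x"
    proof (rule extensionalityI[of _ I])
      show "x \<in> extensional I"
        using x by (auto simp: direct_sum_def PiE_iff)
      fix i
      assume "i \<in> I"
      then show "x i = (truncate J x \<otimes>\<^bsub>SumG\<^esub> truncate (I - J) x) i"
        using group_G xi by (auto simp: truncate_def group.is_monoid monoid.l_one monoid.r_one)
    qed auto
    moreover have "\<phi> (truncate (I - J) x) = 0"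
      using J(2) by (intro kill truncate_in_direct_sum x) (auto simp: truncate_def)
    ultimately have "\<phi> x = wrap (\<phi> (truncate J x))"
      using character_mult[OF \<phi>, of "truncate J x" "truncate (I - J) x"] truncate_in_direct_sum[OF x] by simp
    then show "\<phi> x = wrap (\<Sum>i\<in>J. \<phi> (single i (x i)))"
      using character_truncate[OF \<phi> x J] by (simp add: wrap_wrap_add(1)[of _ 0, simplified])
  qed
qed

lemma sum_of_characters_on_Prod:
  assumes "finite J" "J \<subseteq> I" "\<And>i. i \<in> I \<Longrightarrow> g i \<in> characters (G i) (T i)"
  shows "(\<lambda>x\<in>carrier ProdG. wrap (\<Sum>i\<in>J. g i (x i))) \<in> characters ProdG ProdT"
proof (rule wrap_phase_in_characters[OF group_Prod topspace_Prod])
  show "continuous_map ProdT euclidean (\<lambda>x. cis (2 * pi * (\<Sum>i\<in>J. g i (x i))))"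
    using assms(1,2)
  proof (induction J rule: finite_induct)
    case (insert j J)
    have "continuous_map ProdT euclidean ((\<lambda>t. cis (2 * pi * g j t)) \<circ> (\<lambda>x. x j))"
      using insert.prems assms(3)
      by (intro continuous_map_compose[OF continuous_map_product_projection] continuous_map_cis_character) auto
    then show ?case
      using insert continuous_map_mult_complex[of ProdT "\<lambda>x. cis (2 * pi * g j (x j))"]
      by (simp add: comp_def distrib_left flip: cis_mult)
  qed simp
  fix x y
  assume xy: "x \<in> carrier ProdG" "y \<in> carrier ProdG"
  show "cis (2 * pi * (\<Sum>i\<in>J. g i ((x \<otimes>\<^bsub>ProdG\<^esub> y) i)))
      = cis (2 * pi * (\<Sum>i\<in>J. g i (x i))) * cis (2 * pi * (\<Sum>i\<in>J. g i (y i)))"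
    using assms(1,2)
  proof (induction J rule: finite_induct)
    case (insert j J)
    have "x j \<in> carrier (G j)" "y j \<in> carrier (G j)" "j \<in> I"
      using xy insert.prems by auto
    then show ?case
      using insert cis_character_mult[OF assms(3), of j "x j" "y j"]
      by (simp add: distrib_left flip: cis_mult)
  qed simp
qed

text \<open>
  The finite sum over the coordinates on which \<open>\<phi>\<close> depends makes sense on the whole product. The
  last conclusion is how vanishing in every coordinate is passed on to the extension.
\<close>

lemma character_extension_from_coordinates:
  assumes \<phi>: "\<phi> \<in> characters SumG SumT"
    and g: "\<And>i. i \<in> I \<Longrightarrow> g i \<in> characters (G i) (T i)"
    and g_eq: "\<And>i. i \<in> I \<Longrightarrow> restrict (g i) (D i) = coordinate_character \<phi> i"
  obtains h where "h \<in> characters ProdG ProdT" "restrict h sum_carrier = \<phi>"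
    "\<And>x. x \<in> carrier ProdG \<Longrightarrow> (\<And>i. i \<in> I \<Longrightarrow> g i (x i) = 0) \<Longrightarrow> h x = 0"
proof -
  obtain J where J: "finite J" "J \<subseteq> I"
    and \<phi>_eq: "\<And>x. x \<in> sum_carrier \<Longrightarrow> \<phi> x = wrap (\<Sum>i\<in>J. \<phi> (single i (x i)))"
    using character_eq_finite_sum[OF \<phi>] by blast
  define h where "h = (\<lambda>x\<in>carrier ProdG. wrap (\<Sum>i\<in>J. g i (x i)))"
  show ?thesis
  proof (rule that)
    show "h \<in> characters ProdG ProdT"
      unfolding h_def by (intro sum_of_characters_on_Prod J g)
    show "restrict h sum_carrier = \<phi>"
    proof (rule extensionalityI[of _ sum_carrier])
      show "\<phi> \<in> extensional sum_carrier"
        using \<phi> by (simp add: characters_def)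
      fix x
      assume x: "x \<in> sum_carrier"
      have "g i (x i) = \<phi> (single i (x i))" if "i \<in> J" for i
      proof -
        have "i \<in> I" "x i \<in> D i"
          using that J(2) Sum_coord[OF x] by auto
        then show ?thesis
          using fun_cong[OF g_eq[of i], of "x i"] by (simp add: coordinate_character_def)
      qed
      then show "restrict h sum_carrier x = \<phi> x"
        using x subsetD[OF direct_sum_subset x] \<phi>_eq[OF x] by (simp add: h_def)
    qed simp
    fix x
    assume "x \<in> carrier ProdG" "\<And>i. i \<in> I \<Longrightarrow> g i (x i) = 0"
    moreover from this have "(\<Sum>i\<in>J. g i (x i)) = 0"
      using J(2) by (intro sum.neutral) auto
    ultimately show "h x = 0"
      by (simp add: h_def)
  qed
qed

text \<open>
  The pieces of the axes converge to the identity: the member of an open cover that contains the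
  identity contains all pieces but finitely many, and those form a compact set.
\<close>

lemma compactin_union_of_axes:
  assumes C: "\<And>i. i \<in> I \<Longrightarrow> compactin (SubT i) (C i)"
  shows "compactin SumT (insert \<one>\<^bsub>SumG\<^esub> (\<Union>i\<in>I. single i ` C i))"
proof -
  have axis: "compactin SumT (single i ` C i)" if "i \<in> I" for i
    using image_compactin[OF C[OF that] continuous_map_single[OF that]] .
  have one_in: "\<one>\<^bsub>SumG\<^esub> \<in> topspace SumT"
    using monoid.one_closed[OF group.is_monoid[OF group_Sum]] unfolding topspace_Sum .
  show ?thesis
    unfolding compactin_def
  proof (intro conjI allI impI)
    show "insert \<one>\<^bsub>SumG\<^esub> (\<Union>i\<in>I. single i ` C i) \<subseteq> topspace SumT"
      using one_in compactin_subset_topspace[OF axis] by blast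
    fix \<U>
    assume \<U>: "Ball \<U> (openin SumT) \<and> insert \<one>\<^bsub>SumG\<^esub> (\<Union>i\<in>I. single i ` C i) \<subseteq> \<Union>\<U>"
    then obtain V where V: "V \<in> \<U>" "\<one>\<^bsub>SumG\<^esub> \<in> V"
      by auto
    then obtain W where W: "openin ProdT W" "V = W \<inter> sum_carrier"
      using \<U> by (auto simp: openin_subtopology)
    then have "(\<lambda>i\<in>I. \<one>\<^bsub>G i\<^esub>) \<in> W"
      using V(2) by simp
    from W(1)[unfolded openin_product_topology_alt, THEN bspec, OF this]
    obtain U where fin: "finite {i \<in> I. U i \<noteq> topspace (T i)}"
      and one: "(\<lambda>i\<in>I. \<one>\<^bsub>G i\<^esub>) \<in> Pi\<^sub>E I U" and U: "Pi\<^sub>E I U \<subseteq> W"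
      by blast
    define J where "J = {i \<in> I. U i \<noteq> topspace (T i)}"
    have far: "single i c \<in> V" if i: "i \<in> I - J" and c: "c \<in> C i" for i c
    proof -
      have "i \<in> I" "c \<in> D i" "c \<in> topspace (T i)"
        using i c compactin_subset_topspace[OF C[of i]] by auto
      then have "single i c \<in> Pi\<^sub>E I U"
        using i PiE_mem[OF one] by (auto simp: single_def J_def)
      then show ?thesis
        using U W(2) single_in_direct_sum[OF \<open>i \<in> I\<close> \<open>c \<in> D i\<close>] by blast
    qed
    have "compactin SumT (\<Union>i\<in>J. single i ` C i)"
      using fin axis by (intro compactin_Union) (auto simp: J_def)
    moreover have "(\<Union>i\<in>J. single i ` C i) \<subseteq> \<Union>\<U>"
      using \<U> by (auto simp: J_def)
    ultimately obtain \<F> where \<F>: "finite \<F>" "\<F> \<subseteq> \<U>" "(\<Union>i\<in>J. single i ` C i) \<subseteq> \<Union>\<F>"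
      using \<U> unfolding compactin_def by meson
    show "\<exists>\<F>. finite \<F> \<and> \<F> \<subseteq> \<U> \<and> insert \<one>\<^bsub>SumG\<^esub> (\<Union>i\<in>I. single i ` C i) \<subseteq> \<Union>\<F>"
    proof (intro exI[of _ "insert V \<F>"] conjI)
      show "insert \<one>\<^bsub>SumG\<^esub> (\<Union>i\<in>I. single i ` C i) \<subseteq> \<Union>(insert V \<F>)"
      proof (intro insert_subsetI UN_least image_subsetI)
        fix i c
        assume "i \<in> I" "c \<in> C i"
        then show "single i c \<in> \<Union>(insert V \<F>)"
          using far[of i c] \<F>(3) by (cases "i \<in> J") auto
      qed (use V(2) in blast)
    qed (use \<F> V(1) in auto)
  qed
qed

text \<open>
  A basic open set restricts finitely many coordinates; density of \<open>D i\<close> is used at these, and the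
  neutral element serves at all others.
\<close>

lemma direct_sum_dense:
  assumes "\<And>i. i \<in> I \<Longrightarrow> T i closure_of D i = topspace (T i)"
  shows "ProdT closure_of sum_carrier = topspace ProdT"
proof (intro equalityI closure_of_subset_topspace subsetI)
  fix x
  assume x: "x \<in> topspace ProdT"
  show "x \<in> ProdT closure_of sum_carrier"
    unfolding in_closure_of
  proof (intro conjI allI impI x)
    fix W
    assume W: "x \<in> W \<and> openin ProdT W"
    from conjunct2[OF W, unfolded openin_product_topology_alt, THEN bspec, OF conjunct1[OF W]]
    obtain U where fin: "finite {i \<in> I. U i \<noteq> topspace (T i)}"
      and op: "\<And>i. i \<in> I \<Longrightarrow> openin (T i) (U i)" and xU: "x \<in> Pi\<^sub>E I U" and U: "Pi\<^sub>E I U \<subseteq> W"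
      by blast
    have "\<exists>d. d \<in> D i \<and> d \<in> U i" if i: "i \<in> I" for i
    proof -
      have "x i \<in> T i closure_of D i"
        using x i assms[OF i] by auto
      then show ?thesis
        using op[OF i] PiE_mem[OF xU i] unfolding in_closure_of by blast
    qed
    then obtain d where d: "\<And>i. i \<in> I \<Longrightarrow> d i \<in> D i \<and> d i \<in> U i"
      by metis
    define y where "y = (\<lambda>i\<in>I. if U i = topspace (T i) then \<one>\<^bsub>G i\<^esub> else d i)"
    have "{i \<in> I. y i \<noteq> \<one>\<^bsub>G i\<^esub>} \<subseteq> {i \<in> I. U i \<noteq> topspace (T i)}"
      by (auto simp: y_def)
    then have "finite {i \<in> I. y i \<noteq> \<one>\<^bsub>G i\<^esub>}"
      using fin by (rule finite_subset)
    then have "y \<in> sum_carrier"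
      using d one_in_D by (auto simp: direct_sum_def y_def)
    moreover have "y \<in> Pi\<^sub>E I U"
      using d one_in_G topspace_T by (auto simp: y_def)
    ultimately show "\<exists>y. y \<in> sum_carrier \<and> y \<in> W"
      using U by blast
  qed
qed

end

section \<open>Determining subgroups\<close>

lemma restrict_character:
  assumes "group G" "topspace T = carrier G" "subgroup D G" "h \<in> characters G T"
  shows "restrict h D \<in> characters (G\<lparr>carrier := D\<rparr>) (subtopology T D)"
proof -
  have D: "D \<subseteq> carrier G"
    using assms(3) by (rule subgroup.subset)
  have "(\<lambda>x\<in>carrier (G\<lparr>carrier := D\<rparr>). h (id x)) \<in> characters (G\<lparr>carrier := D\<rparr>) (subtopology T D)"
  proof (rule character_comp_hom[OF _ _ _ _ assms(4)])
    show "group (G\<lparr>carrier := D\<rparr>)"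
      using group.subgroup_imp_group[OF assms(1,3)] .
    show "id \<in> hom (G\<lparr>carrier := D\<rparr>) G"
      using D by (auto simp: hom_def)
    show "continuous_map (subtopology T D) T id"
      by (intro continuous_map_from_subtopology continuous_map_id)
  qed (use assms(2) D in auto)
  then show ?thesis
    by simp
qed

lemma continuous_map_square_subgroup:
  assumes "topological_comm_group G T" "subgroup D G"
  shows "continuous_map (subtopology T D) (subtopology T D)
    (\<lambda>x. x \<otimes>\<^bsub>G\<lparr>carrier := D\<rparr>\<^esub> x)"
proof -
  have "continuous_map T T ((\<lambda>(x, y). x \<otimes>\<^bsub>G\<^esub> y) \<circ> (\<lambda>x. (x, x)))"
    using assms(1) unfolding topological_comm_group_def
    by (intro continuous_map_compose[of T "prod_topology T T"] continuous_map_pairedI) auto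
  then have "continuous_map (subtopology T D) T (\<lambda>x. x \<otimes>\<^bsub>G\<^esub> x)"
    by (intro continuous_map_from_subtopology) (simp add: comp_def)
  then show ?thesis
    using subgroup.m_closed[OF assms(2)] by (auto simp: continuous_map_in_subtopology)
qed

text \<open>
  Restriction to a determining subgroup is an open map, so smallness on a compact subset of the
  group is implied by smallness on a compact subset of the subgroup.
\<close>

lemma determines_quarter_nbhd:
  assumes G: "topological_comm_group G T" and det: "determines D G T" and F: "compactin T F"
  shows "\<exists>C. compactin (subtopology T D) C \<and>
    (\<forall>h\<in>characters G T. restrict h D \<in> quarter_nbhd (G\<lparr>carrier := D\<rparr>) (subtopology T D) C
      \<longrightarrow> h \<in> quarter_nbhd G T F)"
proof -
  let ?H = "G\<lparr>carrier := D\<rparr>" and ?S = "subtopology T D"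
  have grp: "group G" and T: "topspace T = carrier G"
    using G by (auto simp: topological_comm_group_def comm_group_def)
  have D: "subgroup D G"
    and homeo: "homeomorphic_map (dual_topology G T) (dual_topology ?H ?S) (\<lambda>h. restrict h D)"
    using det by (auto simp: determines_def dense_subgroup_def)
  have S: "topspace ?S = carrier ?H"
    using T subgroup.subset[OF D] by auto
  define W where "W = (\<lambda>h. restrict h D) ` quarter_nbhd G T F"
  have "openin (dual_topology ?H ?S) W"
    using homeomorphic_imp_open_map[OF homeo] openin_quarter_nbhd[OF F]
    unfolding W_def open_map_def by blast
  moreover have "(\<lambda>x\<in>carrier ?H. 0) \<in> W"
    unfolding W_def
  proof (rule image_eqI)
    show "(\<lambda>x\<in>carrier G. 0) \<in> quarter_nbhd G T F"
      using zero_character[OF grp T] compactin_subset_topspace[OF F] T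
      by (auto simp: quarter_nbhd_def)
    show "(\<lambda>x\<in>carrier ?H. 0) = restrict (\<lambda>x\<in>carrier G. 0) D"
      using subgroup.subset[OF D] by (auto simp: fun_eq_iff)
  qed
  ultimately obtain C where C: "compactin ?S C" "quarter_nbhd ?H ?S C \<subseteq> W"
    using dual_nbhd_zero_contains_quarter_nbhd[OF continuous_map_square_subgroup[OF G D] S] by blast
  have "h \<in> quarter_nbhd G T F"
    if h: "h \<in> characters G T" and small: "restrict h D \<in> quarter_nbhd ?H ?S C" for h
  proof -
    obtain k where k: "k \<in> quarter_nbhd G T F" "restrict h D = restrict k D"
      using C(2) small unfolding W_def by auto
    moreover have "k \<in> characters G T"
      using k(1) by (simp add: quarter_nbhd_def)
    ultimately show ?thesis
      using inj_onD[OF homeomorphic_imp_injective_map[OF homeo], of h k] h by simp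
  qed
  then show ?thesis
    using C(1) by blast
qed

text \<open>
  The cofinally zero property of the group is thereby tested on compact subsets of \<open>D\<close> alone.
\<close>

lemma determines_cofinally_zero:
  assumes "topological_comm_group G T" "determines D G T" "cofinally_zero G T" "compactin T K"
  shows "\<exists>C. compactin (subtopology T D) C \<and>
    (\<forall>h\<in>characters G T. restrict h D \<in> quarter_nbhd (G\<lparr>carrier := D\<rparr>) (subtopology T D) C
      \<longrightarrow> (\<forall>x\<in>K. h x = 0))"
proof -
  obtain F where F: "compactin T F" "\<And>h x. h \<in> quarter_nbhd G T F \<Longrightarrow> x \<in> K \<Longrightarrow> h x = 0"
    using assms(3,4) unfolding cofinally_zero_def by blast
  show ?thesis
    using determines_quarter_nbhd[OF assms(1,2) F(1)] F(2) by meson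
qed

lemma determines_extend_character:
  assumes "determines D G T" "k \<in> characters (G\<lparr>carrier := D\<rparr>) (subtopology T D)"
  shows "\<exists>h\<in>characters G T. restrict h D = k"
proof -
  have "(\<lambda>h. restrict h D) ` characters G T = characters (G\<lparr>carrier := D\<rparr>) (subtopology T D)"
    using assms(1) homeomorphic_imp_surjective_map unfolding determines_def
    by (metis topspace_dual_topology)
  then show ?thesis
    using assms(2) by (metis imageE)
qed

context subgroups_of_topological_groups
begin

lemma coordinate_extensions:
  assumes det: "\<And>i. i \<in> I \<Longrightarrow> determines (D i) (G i) (T i)"
    and \<phi>: "\<phi> \<in> characters SumG SumT"
  obtains g where "\<And>i. i \<in> I \<Longrightarrow> g i \<in> characters (G i) (T i)"
    "\<And>i. i \<in> I \<Longrightarrow> restrict (g i) (D i) = coordinate_character \<phi> i"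
proof -
  have "\<forall>i\<in>I. \<exists>h. h \<in> characters (G i) (T i) \<and> restrict h (D i) = coordinate_character \<phi> i"
    using determines_extend_character[OF det coordinate_character[OF \<phi>]] by blast
  then show ?thesis
    using that by (subst (asm) bchoice_iff) blast
qed

text \<open>
  The conclusion holds for an arbitrary character that is small on \<open>F\<close>, with no regard to how many
  coordinates it involves, because each summand of its extension vanishes on \<open>K\<close>.
\<close>

lemma extend_small_character_vanishing_on_compact:
  assumes det: "\<And>i. i \<in> I \<Longrightarrow> determines (D i) (G i) (T i)"
    and cz: "\<And>i. i \<in> I \<Longrightarrow> cofinally_zero (G i) (T i)"
    and K: "compactin ProdT K"
  obtains F where "compactin SumT F"
    "\<And>\<phi>. \<phi> \<in> quarter_nbhd SumG SumT F \<Longrightarrow>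
      \<exists>h\<in>characters ProdG ProdT. restrict h sum_carrier = \<phi> \<and> (\<forall>x\<in>K. h x = 0)"
proof -
  have "compactin (T i) ((\<lambda>x. x i) ` K)" if "i \<in> I" for i
    using image_compactin[OF K continuous_map_product_projection[OF that]] .
  then have "\<forall>i\<in>I. \<exists>C. compactin (SubT i) C \<and>
    (\<forall>h\<in>characters (G i) (T i). restrict h (D i) \<in> quarter_nbhd (SubG i) (SubT i) C
      \<longrightarrow> (\<forall>x\<in>(\<lambda>x. x i) ` K. h x = 0))"
    using determines_cofinally_zero[OF topological_comm_group det cz] by blast
  then obtain C where C: "\<And>i. i \<in> I \<Longrightarrow> compactin (SubT i) (C i)"
    and vanish: "\<And>i h x. i \<in> I \<Longrightarrow> h \<in> characters (G i) (T i) \<Longrightarrow>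
      restrict h (D i) \<in> quarter_nbhd (SubG i) (SubT i) (C i) \<Longrightarrow> x \<in> K \<Longrightarrow> h (x i) = 0"
    by (subst (asm) bchoice_iff) blast
  define F where "F = insert \<one>\<^bsub>SumG\<^esub> (\<Union>i\<in>I. single i ` C i)"
  show ?thesis
  proof (rule that)
    show "compactin SumT F"
      unfolding F_def by (rule compactin_union_of_axes[OF C])
    fix \<phi>
    assume small: "\<phi> \<in> quarter_nbhd SumG SumT F"
    then have \<phi>: "\<phi> \<in> characters SumG SumT"
      by (simp add: quarter_nbhd_def)
    obtain g where g: "\<And>i. i \<in> I \<Longrightarrow> g i \<in> characters (G i) (T i)"
      and g_eq: "\<And>i. i \<in> I \<Longrightarrow> restrict (g i) (D i) = coordinate_character \<phi> i"
      using coordinate_extensions[OF det \<phi>] by blast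
    obtain h where h: "h \<in> characters ProdG ProdT" "restrict h sum_carrier = \<phi>"
      and h_zero: "\<And>x. x \<in> carrier ProdG \<Longrightarrow> (\<And>i. i \<in> I \<Longrightarrow> g i (x i) = 0) \<Longrightarrow> h x = 0"
      using character_extension_from_coordinates[OF \<phi> g g_eq] by blast
    have "h x = 0" if x: "x \<in> K" for x
    proof (rule h_zero)
      show "x \<in> carrier ProdG"
        using compactin_subset_topspace[OF K] x unfolding topspace_Prod by blast
      fix i
      assume i: "i \<in> I"
      have "C i \<subseteq> D i"
        using compactin_subset_topspace[OF C[OF i]] by simp
      then have "coordinate_character \<phi> i \<in> quarter_nbhd (SubG i) (SubT i) (C i)"
        using small i coordinate_character[OF \<phi> i]
        by (auto simp: quarter_nbhd_def coordinate_character_def F_def)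
      then show "g i (x i) = 0"
        using vanish[OF i g[OF i] _ x] g_eq[OF i] by simp
    qed
    then show "\<exists>h\<in>characters ProdG ProdT. restrict h sum_carrier = \<phi> \<and> (\<forall>x\<in>K. h x = 0)"
      using h by blast
  qed
qed

text \<open>
  The inverse of restriction is locally constant in the following sense: near a given character of
  the direct sum, the extensions all have the same restriction to the compact set \<open>K\<close>.
\<close>

lemma direct_sum_determines:
  assumes det: "\<And>i. i \<in> I \<Longrightarrow> determines (D i) (G i) (T i)"
    and cz: "\<And>i. i \<in> I \<Longrightarrow> cofinally_zero (G i) (T i)"
  shows "determines sum_carrier ProdG ProdT"
proof -
  let ?r = "\<lambda>h. restrict h sum_carrier"
  have dense: "ProdT closure_of sum_carrier = topspace ProdT"
    using det by (intro direct_sum_dense) (auto simp: determines_def dense_subgroup_def)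
  have restrict: "?r h \<in> characters SumG SumT" if "h \<in> characters ProdG ProdT" for h
    using restrict_character[OF group_Prod topspace_Prod subgroup_direct_sum that] .
  have unique: "h = k"
    if "h \<in> characters ProdG ProdT" "k \<in> characters ProdG ProdT" "?r h = ?r k" for h k
    using that(1,2)
  proof (rule characters_eqI_dense[OF dense topspace_Prod])
    fix x
    assume "x \<in> sum_carrier"
    then show "h x = k x"
      using fun_cong[OF that(3), of x] by simp
  qed
  have extension: "\<exists>h\<in>characters ProdG ProdT. ?r h = \<phi>" if \<phi>: "\<phi> \<in> characters SumG SumT" for \<phi>
    using coordinate_extensions[OF det \<phi>] character_extension_from_coordinates[OF \<phi>] by metis
  define ext where "ext \<phi> = (SOME h. h \<in> characters ProdG ProdT \<and> ?r h = \<phi>)" for \<phi>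
  have ext: "ext \<phi> \<in> characters ProdG ProdT" "?r (ext \<phi>) = \<phi>" if "\<phi> \<in> characters SumG SumT" for \<phi>
    using someI_ex[of "\<lambda>h. h \<in> characters ProdG ProdT \<and> ?r h = \<phi>"] extension[OF that]
    unfolding ext_def by blast+
  have "continuous_map (dual_topology ProdG ProdT) (dual_topology SumG SumT) ?r"
  proof (rule continuous_map_into_dualI)
    fix K V
    assume K: "compactin SumT K" and V: "openin circle_topology V"
    have K': "compactin ProdT K" "K \<subseteq> sum_carrier"
      using K by (auto simp: compactin_subtopology)
    have "?r h ` K = h ` K" for h :: "('i \<Rightarrow> 'a) \<Rightarrow> real"
      using K'(2) by (intro image_cong) auto
    then show "openin (dual_topology ProdG ProdT) {h \<in> topspace (dual_topology ProdG ProdT). ?r h ` K \<subseteq> V}"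
      using openin_dual_subbasic[OF K'(1) V, of ProdG] by simp
  qed (use restrict in auto)
  moreover have "continuous_map (dual_topology SumG SumT) (dual_topology ProdG ProdT) ext"
  proof (rule continuous_map_into_dualI)
    fix K V
    assume K: "compactin ProdT K" and V: "openin circle_topology V"
    obtain F where F: "compactin SumT F"
      and vanish: "\<And>\<eta>. \<eta> \<in> quarter_nbhd SumG SumT F \<Longrightarrow>
        \<exists>h\<in>characters ProdG ProdT. ?r h = \<eta> \<and> (\<forall>x\<in>K. h x = 0)"
      using extend_small_character_vanishing_on_compact[OF det cz K] by blast
    have K_sub: "K \<subseteq> carrier ProdG"
      using compactin_subset_topspace[OF K] unfolding topspace_Prod .
    have F_sub: "F \<subseteq> sum_carrier"
      using compactin_subset_topspace[OF F] by auto
    let ?E = "{\<phi> \<in> topspace (dual_topology SumG SumT). ext \<phi> ` K \<subseteq> V}"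
    have same: "ext \<psi> x = ext \<phi> x"
      if \<phi>: "\<phi> \<in> characters SumG SumT" and \<psi>: "\<psi> \<in> characters SumG SumT"
        and close: "\<And>x. x \<in> F \<Longrightarrow> \<bar>wrap (\<psi> x - \<phi> x)\<bar> < 1/4" and x: "x \<in> K" for \<phi> \<psi> x
    proof -
      \<comment> \<open>The difference is small on \<open>F\<close>, so its extension \<open>e\<close> vanishes on \<open>K\<close>; adding \<open>e\<close> to the
        extension of \<open>\<phi>\<close> gives the extension of \<open>\<psi>\<close>.\<close>
      define \<eta> where "\<eta> = (\<lambda>x\<in>carrier SumG. wrap (\<psi> x - \<phi> x))"
      have "\<eta> \<in> quarter_nbhd SumG SumT F"
        using character_diff[OF group_Sum topspace_Sum \<psi> \<phi>] close F_sub
        by (auto simp: quarter_nbhd_def \<eta>_def)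
      then obtain e where e: "e \<in> characters ProdG ProdT" "?r e = \<eta>" "\<And>x. x \<in> K \<Longrightarrow> e x = 0"
        using vanish by blast
      define k where "k = (\<lambda>x\<in>carrier ProdG. wrap (ext \<phi> x + e x))"
      have "ext \<psi> = k"
      proof (rule unique[OF ext(1)[OF \<psi>]])
        show "k \<in> characters ProdG ProdT"
          unfolding k_def by (intro character_add group_Prod topspace_Prod ext \<phi> e)
        have "?r k y = \<psi> y" if y: "y \<in> sum_carrier" for y
        proof -
          have "ext \<phi> y = \<phi> y" "e y = \<eta> y"
            using fun_cong[OF ext(2)[OF \<phi>], of y] fun_cong[OF e(2), of y] y by simp_all
          then have "?r k y = wrap (\<psi> y)"
            using y subsetD[OF direct_sum_subset y] by (simp add: k_def \<eta>_def wrap_wrap_add)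
          then show ?thesis
            using character_wrap[OF \<psi>, of y] y by simp
        qed
        then have "?r k = \<psi>"
          using \<psi> by (intro extensionalityI[of _ sum_carrier]) (auto simp: characters_def)
        then show "?r (ext \<psi>) = ?r k"
          using ext(2)[OF \<psi>] by simp
      qed
      then show ?thesis
        using x subsetD[OF K_sub x] e(3)[OF x] character_wrap[OF ext(1)[OF \<phi>], of x]
        by (simp add: k_def)
    qed
    show "openin (dual_topology SumG SumT) ?E"
    proof (subst openin_subopen, intro ballI)
      fix \<phi>
      assume "\<phi> \<in> ?E"
      then have \<phi>: "\<phi> \<in> characters SumG SumT" "ext \<phi> ` K \<subseteq> V"
        by auto
      obtain W where W: "openin (dual_topology SumG SumT) W" "\<phi> \<in> W"
        and close: "\<And>\<psi> x. \<psi> \<in> W \<Longrightarrow> x \<in> F \<Longrightarrow> \<bar>wrap (\<psi> x - \<phi> x)\<bar> < 1/4"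
        using dual_nbhd_translate[OF topspace_Sum \<phi>(1) F] by blast
      have "W \<subseteq> ?E"
      proof
        fix \<psi>
        assume \<psi>: "\<psi> \<in> W"
        then have \<psi>': "\<psi> \<in> characters SumG SumT"
          using openin_subset[OF W(1)] by auto
        have "ext \<psi> ` K = ext \<phi> ` K"
          using same[OF \<phi>(1) \<psi>' close[OF \<psi>]] by (intro image_cong) auto
        then show "\<psi> \<in> ?E"
          using \<phi>(2) \<psi>' by simp
      qed
      then show "\<exists>W. openin (dual_topology SumG SumT) W \<and> \<phi> \<in> W \<and> W \<subseteq> ?E"
        using W by blast
    qed
  qed (use ext in auto)
  ultimately have "homeomorphic_maps (dual_topology ProdG ProdT) (dual_topology SumG SumT) ?r ext"
    using restrict ext unique by (auto simp: homeomorphic_maps_def)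
  then show ?thesis
    using subgroup_direct_sum dense unfolding determines_def dense_subgroup_def homeomorphic_map_maps
    by blast
qed

end

theorem lemma3p9:
  fixes I :: "'i set"
    and G :: "'i \<Rightarrow> ('a, 'b) monoid_scheme"
    and T :: "'i \<Rightarrow> 'a topology"
    and D :: "'i \<Rightarrow> 'a set"
  assumes "\<And>i. i \<in> I \<Longrightarrow> topological_comm_group (G i) (T i)"
    and "\<And>i. i \<in> I \<Longrightarrow> Hausdorff_space (T i)"
    and "\<And>i. i \<in> I \<Longrightarrow> locally_bounded_group (G i) (T i)"
    and "\<And>i. i \<in> I \<Longrightarrow> cofinally_zero (G i) (T i)"
    and "\<And>i. i \<in> I \<Longrightarrow> dense_subgroup (D i) (G i) (T i)"
    and "\<And>i. i \<in> I \<Longrightarrow> determines (D i) (G i) (T i)"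
  shows "determines (direct_sum I G D) (product_group I G) (product_topology T I)"
proof -
  interpret subgroups_of_topological_groups I G T D
    by (rule subgroups_of_topological_groups.intro) (use assms(1,5) in \<open>simp_all add: dense_subgroup_def\<close>)
  show ?thesis
    using assms(6,4) by (rule direct_sum_determines)
qed

end
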